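(* For positive integers $M$ and $N$, \[ \overline{\left[\begin{matrix} M+N \\ N\end{matrix}\right]}_q = \sum_{k=0}^{\min\{M,N\}} q^{\frac{k(k+1)}{2}} \frac{(q)_{M+N-k}}{(q)_k\,(q)_{M-k}\,(q)_{N-k}}, \] where the left-hand side is the over $q$-binomial coefficient, i.e. the generating function (in $q$) for the number of overpartitions fitting inside an $M\times N$ rectangle.
   Context: Notation: $(a)_n=(a;q)_n:=\prod_{k=1}^{n}(1-aq^{k-1})$, so $(q)_n=\prod_{k=1}^n(1-q^k)$ and $(q)_0=1$. An overpartition of $n$ is a partition of $n$ in which the last occurrence of each distinct number may be overlined (e.g. there are $8$ overpartitions of $3$). For non-negative integers $M,N$, an overpartition fits inside an $M\times N$ rectangle if its largest part is $\le M$ and its number of parts is $\le N$ (the empty overpartition always fits). The over $q$-binomial coefficient is \[ \overline{\left[\begin{matrix} M+N \\ N\end{matrix}\right]}_q:=\sum_{n\ge 0} O(M,N,n)\,q^n, \] where $O(M,N,n)$ is the number of overpartitions of $n$ fitting inside an $M\times N$ rectangle. *)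

theory Defs
  imports "HOL-Computational_Algebra.Formal_Power_Series"
begin

definition q_pochhammer :: "'a::comm_ring_1 \<Rightarrow> 'a \<Rightarrow> nat \<Rightarrow> 'a" where
  "q_pochhammer a q n = (\<Prod>k=1..n. 1 - a * q ^ (k - 1))"

(* A part is a pair (size, flag), where the flag says whether the part is overlined. *)
definition overpartition :: "(nat \<times> bool) list \<Rightarrow> bool" where
  "overpartition ps \<longleftrightarrow>
     (\<forall>p\<in>set ps. 0 < fst p) \<and>
     sorted_wrt (\<ge>) (map fst ps) \<and>
     (\<forall>i<length ps. snd (ps ! i) \<longrightarrow>
        (\<forall>j. i < j \<and> j < length ps \<longrightarrow> fst (ps ! j) \<noteq> fst (ps ! i)))"

definition overpartitions_of :: "nat \<Rightarrow> (nat \<times> bool) list set" where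
  "overpartitions_of n = {ps. overpartition ps \<and> sum_list (map fst ps) = n}"

definition fits_in_rectangle :: "nat \<Rightarrow> nat \<Rightarrow> (nat \<times> bool) list \<Rightarrow> bool" where
  "fits_in_rectangle M N ps \<longleftrightarrow> (\<forall>p\<in>set ps. fst p \<le> M) \<and> length ps \<le> N"

definition num_overpartitions :: "nat \<Rightarrow> nat \<Rightarrow> nat \<Rightarrow> nat" where
  "num_overpartitions M N n = card {ps \<in> overpartitions_of n. fits_in_rectangle M N ps}"

(* over_q_binomial M N is the over q-binomial coefficient with upper entry M + N and lower
   entry N, as a formal power series in q. *)
definition over_q_binomial :: "nat \<Rightarrow> nat \<Rightarrow> rat fps" where
  "over_q_binomial M N = Abs_fps (\<lambda>n. of_nat (num_overpartitions M N n))"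

lemma finite_overpartitions_of: "finite (overpartitions_of n)"
proof (rule finite_subset)
  show "overpartitions_of n \<subseteq> {ps. set ps \<subseteq> {..n} \<times> UNIV \<and> length ps \<le> n}"
  proof
    fix ps assume "ps \<in> overpartitions_of n"
    then have pos: "\<forall>p\<in>set ps. 0 < fst p" and n: "sum_list (map fst ps) = n"
      by (auto simp: overpartitions_of_def overpartition_def)
    have "fst p \<le> n" if "p \<in> set ps" for p
      using n that member_le_sum_list[of "fst p" "map fst ps"] by auto
    moreover have "length ps \<le> sum_list (map fst ps)"
      using pos by (induction ps) (auto simp: Suc_le_eq less_le_trans)
    ultimately show "ps \<in> {ps. set ps \<subseteq> {..n} \<times> UNIV \<and> length ps \<le> n}"
      using n by auto
  qed
  show "finite {ps. set ps \<subseteq> {..n} \<times> (UNIV :: bool set) \<and> length ps \<le> n}"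
    by (rule finite_lists_length_le) auto
qed

end

(* Removing the largest part of an overpartition gives
     G(M,N) = G(M-1,N) + q^M G(M,N-1) + q^M G(M-1,N-1)
   for the over q-binomial coefficients G: the part M is absent, or the first part is a
   non-overlined M, or it is an overlined M, in which case M does not occur again.
   With m = M - k and n = N - k, the k-th summand is q^(k(k+1)/2) times a q-multinomial
   coefficient, and
     1 - q^(k+m+n) = (1 - q^m) + q^m (1 - q^k) + q^(m+k) (1 - q^n)
   shows that the summands satisfy the same recurrence, the last term being taken at k-1. *)
theory Submission
  imports Defs
begin

section \<open>Overpartitions in a rectangle and their recurrence\<close>

definition fitting_overpartitions :: "nat \<Rightarrow> nat \<Rightarrow> nat \<Rightarrow> (nat \<times> bool) list set" where
  "fitting_overpartitions M N n = {ps \<in> overpartitions_of n. fits_in_rectangle M N ps}"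

lemma finite_fitting_overpartitions: "finite (fitting_overpartitions M N n)"
  unfolding fitting_overpartitions_def using finite_overpartitions_of by simp

lemma overpartition_Nil: "overpartition []"
  by (simp add: overpartition_def)

text \<open>An overlined part is the last of its size, so an overlined head of size \<open>a\<close>
  forbids \<open>a\<close> in the tail; the conditions on later positions concern the tail
  alone.\<close>

lemma overpartition_Cons:
  "overpartition ((a, b) # ps) \<longleftrightarrow>
     0 < a \<and> overpartition ps \<and> (\<forall>p\<in>set ps. fst p \<le> a \<and> (b \<longrightarrow> fst p \<noteq> a))"
proof -
  \<comment> \<open>These re-index the later positions \<open>j\<close> from the whole list to the
    tail, for the head (position 0) and for a tail entry (position \<open>Suc i\<close>).\<close>
  have shift: "(\<forall>j. 0 < j \<and> j < Suc l \<longrightarrow> P j) \<longleftrightarrow> (\<forall>j<l. P (Suc j))"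
    "(\<forall>j. Suc i < j \<and> j < Suc l \<longrightarrow> P j) \<longleftrightarrow> (\<forall>j. i < j \<and> j < l \<longrightarrow> P (Suc j))"
    for P and i l :: nat
    by (metis Suc_less_eq gr0_conv_Suc, metis Suc_less_eq Suc_lessE)
  have "(\<forall>i<length ((a, b) # ps). snd (((a, b) # ps) ! i) \<longrightarrow>
          (\<forall>j. i < j \<and> j < length ((a, b) # ps) \<longrightarrow>
             fst (((a, b) # ps) ! j) \<noteq> fst (((a, b) # ps) ! i)))
     \<longleftrightarrow> (b \<longrightarrow> (\<forall>j<length ps. fst (ps ! j) \<noteq> a)) \<and>
        (\<forall>i<length ps. snd (ps ! i) \<longrightarrow>
          (\<forall>j. i < j \<and> j < length ps \<longrightarrow> fst (ps ! j) \<noteq> fst (ps ! i)))"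
    unfolding length_Cons All_less_Suc2 shift by simp
  moreover have "(\<forall>j<length ps. fst (ps ! j) \<noteq> a) \<longleftrightarrow> (\<forall>p\<in>set ps. fst p \<noteq> a)"
    by (auto simp: all_set_conv_all_nth)
  ultimately show ?thesis
    unfolding overpartition_def by auto
qed

lemma Nil_in_fitting_overpartitions: "[] \<in> fitting_overpartitions M N n \<longleftrightarrow> n = 0"
  by (auto simp: fitting_overpartitions_def overpartitions_of_def fits_in_rectangle_def
      overpartition_Nil)

text \<open>A plain head may be followed by parts of its own size, an overlined one only by smaller
  parts; hence the two bounds for the tail. The condition \<open>a \<le> n\<close> keeps
  \<open>n - a\<close> from being truncated.\<close>

lemma Cons_in_fitting_overpartitions:
  "(a, b) # ps \<in> fitting_overpartitions M N n \<longleftrightarrow>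
     0 < a \<and> a \<le> M \<and> a \<le> n \<and> 0 < N \<and>
     ps \<in> fitting_overpartitions (if b then a - 1 else a) (N - 1) (n - a)"
  by (force simp: fitting_overpartitions_def overpartitions_of_def fits_in_rectangle_def
      overpartition_Cons)

lemma fitting_overpartitions_0:
  assumes "M = 0 \<or> N = 0"
  shows "fitting_overpartitions M N n = (if n = 0 then {[]} else {})"
proof -
  have "ps \<in> fitting_overpartitions M N n \<longleftrightarrow> ps = [] \<and> n = 0" for ps
    using assms
    by (cases ps) (auto simp: Nil_in_fitting_overpartitions Cons_in_fitting_overpartitions)
  then show ?thesis by auto
qed

lemma fitting_overpartitions_Suc:
  "fitting_overpartitions (Suc M) (Suc N) n =
     fitting_overpartitions M (Suc N) n \<union>
     (if Suc M \<le> n then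
        (#) (Suc M, False) ` fitting_overpartitions (Suc M) N (n - Suc M) \<union>
        (#) (Suc M, True) ` fitting_overpartitions M N (n - Suc M)
      else {})"
proof (rule set_eqI)
  fix ps
  show "ps \<in> fitting_overpartitions (Suc M) (Suc N) n \<longleftrightarrow>
    ps \<in> fitting_overpartitions M (Suc N) n \<union>
     (if Suc M \<le> n then
        (#) (Suc M, False) ` fitting_overpartitions (Suc M) N (n - Suc M) \<union>
        (#) (Suc M, True) ` fitting_overpartitions M N (n - Suc M)
      else {})"
  proof (cases ps)
    case Nil
    then show ?thesis by (auto simp: Nil_in_fitting_overpartitions)
  next
    case (Cons p rs)
    obtain a b where "p = (a, b)" by (cases p)
    with Cons show ?thesis
      by (cases b) (auto simp: Cons_in_fitting_overpartitions le_Suc_eq)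
  qed
qed

lemma num_overpartitions_eq_card: "num_overpartitions M N n = card (fitting_overpartitions M N n)"
  by (simp add: num_overpartitions_def fitting_overpartitions_def)

lemma num_overpartitions_Suc:
  "num_overpartitions (Suc M) (Suc N) n =
     num_overpartitions M (Suc N) n +
     (if Suc M \<le> n then num_overpartitions (Suc M) N (n - Suc M) +
        num_overpartitions M N (n - Suc M) else 0)"
proof (cases "Suc M \<le> n")
  case False
  then show ?thesis
    using fitting_overpartitions_Suc[of M N n] by (simp add: num_overpartitions_eq_card)
next
  case True
  let ?A = "fitting_overpartitions M (Suc N) n"
  let ?B = "(#) (Suc M, False) ` fitting_overpartitions (Suc M) N (n - Suc M)"
  let ?C = "(#) (Suc M, True) ` fitting_overpartitions M N (n - Suc M)"
  \<comment> \<open>No member of \<open>?A\<close> has the part \<open>Suc M\<close>; the heads in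
    \<open>?B\<close> and \<open>?C\<close> differ in the flag.\<close>
  have "?A \<inter> (?B \<union> ?C) = {}" and "?B \<inter> ?C = {}"
    by (auto simp: Cons_in_fitting_overpartitions)
  then have "card (?A \<union> (?B \<union> ?C)) = card ?A + (card ?B + card ?C)"
    by (simp add: card_Un_disjoint finite_fitting_overpartitions)
  moreover have "fitting_overpartitions (Suc M) (Suc N) n = ?A \<union> (?B \<union> ?C)"
    using True by (simp only: fitting_overpartitions_Suc if_True)
  ultimately show ?thesis
    using True by (simp add: num_overpartitions_eq_card card_image)
qed

lemma over_q_binomial_0:
  assumes "M = 0 \<or> N = 0"
  shows "over_q_binomial M N = 1"
  using assms by (auto intro!: fps_ext simp: over_q_binomial_def num_overpartitions_eq_card
      fitting_overpartitions_0)

lemma over_q_binomial_Suc: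
  "over_q_binomial (Suc M) (Suc N) =
     over_q_binomial M (Suc N) +
     fps_X ^ Suc M * (over_q_binomial (Suc M) N + over_q_binomial M N)"
  by (rule fps_ext)
    (auto simp: over_q_binomial_def num_overpartitions_Suc fps_X_power_mult_nth
      simp del: power_Suc)

section \<open>q-factorials and the recurrence for the summands\<close>

definition q_factorial :: "nat \<Rightarrow> 'a::field fps" where
  "q_factorial n = q_pochhammer fps_X fps_X n"

lemma q_factorial_0 [simp]: "q_factorial 0 = 1"
  by (simp add: q_factorial_def q_pochhammer_def)

lemma q_factorial_Suc: "q_factorial (Suc n) = q_factorial n * (1 - fps_X ^ Suc n)"
  by (simp add: q_factorial_def q_pochhammer_def)

text \<open>Constant term 1 makes every (q)_n a unit, so its \<open>inverse\<close> is a true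
  inverse of power series.\<close>

lemma q_factorial_nth_0 [simp]: "fps_nth (q_factorial n) 0 = 1"
  by (induction n) (simp_all add: q_factorial_Suc del: power_Suc)

lemma inverse_q_factorial_Suc:
  "inverse (q_factorial n) = (1 - fps_X ^ Suc n) * inverse (q_factorial (Suc n) :: 'a::field fps)"
proof -
  have "fps_nth (1 - fps_X ^ Suc n :: 'a fps) 0 \<noteq> 0" by simp
  then have "(1 - fps_X ^ Suc n) * inverse (1 - fps_X ^ Suc n :: 'a fps) = 1"
    by (rule inverse_mult_eq_1')
  then show ?thesis
    by (simp add: q_factorial_Suc fps_inverse_mult mult.left_commute del: power_Suc)
qed

text \<open>The value 0 for k > min(M,N) avoids truncated subtraction, makes the recurrence hold for
  every k, and lets the sums run past min(M,N).\<close>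

definition over_q_summand :: "nat \<Rightarrow> nat \<Rightarrow> nat \<Rightarrow> 'a::field fps" where
  "over_q_summand M N k =
     (if k \<le> min M N
      then fps_X ^ (k * (k + 1) div 2) *
        (q_factorial (M + N - k) *
         (inverse (q_factorial k) * inverse (q_factorial (M - k)) * inverse (q_factorial (N - k))))
      else 0)"

lemma over_q_summand_Suc:
  "(over_q_summand (Suc M) (Suc N) k :: 'a::field fps) =
     over_q_summand M (Suc N) k + fps_X ^ Suc M * over_q_summand (Suc M) N k +
     (case k of 0 \<Rightarrow> 0 | Suc j \<Rightarrow> fps_X ^ Suc M * over_q_summand M N j)"
proof (cases "k \<le> min (Suc M) (Suc N)")
  case False
  then show ?thesis by (auto simp: over_q_summand_def split: nat.split)
next
  case True
  \<comment> \<open>All four terms become multiples of q^c (q)_s / ((q)_k (q)_m (q)_n), where s = k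
    + m + n - 1.\<close>
  define m n s where "m = Suc M - k" and "n = Suc N - k" and "s = Suc (M + N) - k"
  define I :: "nat \<Rightarrow> 'a fps" where "I i = inverse (q_factorial i)" for i
  define c where "c = k * (k + 1) div 2"
  let ?Q = "q_factorial s :: 'a fps" and ?X = "fps_X :: 'a fps"
  have kmn: "Suc M = k + m" "Suc N = k + n" "Suc M + Suc N - k = Suc s" "Suc s = k + m + n"
    using True by (auto simp: m_def n_def s_def)
  have I: "I i = (1 - ?X ^ Suc i) * I (Suc i)" for i
    unfolding I_def by (rule inverse_q_factorial_Suc)
  have "q_factorial (Suc M + Suc N - k) = ?Q * (1 - ?X ^ (k + m + n))"
    by (simp only: kmn(3) q_factorial_Suc kmn(4)[symmetric])
  then have lhs: "over_q_summand (Suc M) (Suc N) k =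
      ?X ^ c * (?Q * (1 - ?X ^ (k + m + n)) * (I k * I m * I n))"
    using True by (simp only: over_q_summand_def if_True I_def c_def m_def n_def)
  \<comment> \<open>If m = 0, then k = M + 1 is out of range and the factor 1 - q^m vanishes too.
    Otherwise this factor turns 1/(q)_m into 1/(q)_(m-1). The same holds for n in
    \<open>t2\<close>.\<close>
  have t1: "over_q_summand M (Suc N) k = ?X ^ c * (?Q * (I k * ((1 - ?X ^ m) * I m) * I n))"
  proof (cases m)
    case 0
    then have "\<not> k \<le> M" using kmn(1) by simp
    then show ?thesis using 0 by (simp add: over_q_summand_def)
  next
    case (Suc m')
    then have "k \<le> M" "M - k = m'" "M + Suc N - k = s" using kmn s_def by auto
    then show ?thesis
      using True unfolding Suc I[symmetric]
      by (simp add: over_q_summand_def I_def c_def n_def)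
  qed
  have t2: "over_q_summand (Suc M) N k = ?X ^ c * (?Q * (I k * I m * ((1 - ?X ^ n) * I n)))"
  proof (cases n)
    case 0
    then have "\<not> k \<le> N" using kmn(2) by simp
    then show ?thesis using 0 by (simp add: over_q_summand_def)
  next
    case (Suc n')
    then have "k \<le> N" "N - k = n'" "Suc M + N - k = s" using kmn s_def by auto
    then show ?thesis
      using True unfolding Suc I[symmetric]
      by (simp add: over_q_summand_def I_def c_def m_def)
  qed
  \<comment> \<open>At k = 0 the factor 1 - q^k vanishes. For k = j + 1 the differences M - j and N
    - j are again m and n, and c exceeds j(j+1)/2 by k, so that M + 1 + j(j+1)/2 = c + m.\<close>
  have t3: "(case k of 0 \<Rightarrow> 0 | Suc j \<Rightarrow> ?X ^ Suc M * over_q_summand M N j) =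
      ?X ^ (c + m) * (?Q * ((1 - ?X ^ k) * I k * I m * I n))"
  proof (cases k)
    case 0
    then show ?thesis by simp
  next
    case (Suc j)
    have "c = j * (j + 1) div 2 + k" unfolding c_def Suc by simp
    then have "Suc M + j * (j + 1) div 2 = c + m" using kmn(1) by simp
    then have pow: "?X ^ Suc M * ?X ^ (j * (j + 1) div 2) = ?X ^ (c + m)"
      by (metis power_add)
    have "j \<le> min M N" "M - j = m" "N - j = n" "M + N - j = s"
      using True Suc by (auto simp: m_def n_def s_def)
    then have "over_q_summand M N j = ?X ^ (j * (j + 1) div 2) * (?Q * (I j * I m * I n))"
      by (simp add: over_q_summand_def I_def)
    then have "?X ^ Suc M * over_q_summand M N j = ?X ^ (c + m) * (?Q * (I j * I m * I n))"
      using pow by (simp only: mult.assoc[symmetric])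
    then show ?thesis
      unfolding Suc I[symmetric] by simp
  qed
  show ?thesis
    unfolding lhs t1 t2 t3 unfolding kmn(1) by (simp add: algebra_simps power_add)
qed

section \<open>Summation over k and the closed form\<close>

lemma sum_over_q_summand_Suc:
  "(\<Sum>k\<le>Suc K. over_q_summand (Suc M) (Suc N) k) =
     (\<Sum>k\<le>Suc K. over_q_summand M (Suc N) k) +
     fps_X ^ Suc M * ((\<Sum>k\<le>Suc K. over_q_summand (Suc M) N k) +
       (\<Sum>k\<le>K. over_q_summand M N k) :: 'a::field fps)"
proof -
  \<comment> \<open>Shifting the index drops the zero term at k = 0 and lowers the upper limit to
    \<open>K\<close>.\<close>
  have "(\<Sum>k\<le>Suc K. case k of 0 \<Rightarrow> 0 :: 'a fps | Suc j \<Rightarrow> fps_X ^ Suc M * over_q_summand M N j) =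
      fps_X ^ Suc M * (\<Sum>k\<le>K. over_q_summand M N k)"
    by (subst sum.atMost_Suc_shift) (simp add: sum_distrib_left del: power_Suc)
  then show ?thesis
    by (simp only: over_q_summand_Suc sum.distrib sum_distrib_left distrib_left add.assoc)
qed

lemma sum_over_q_summand_0:
  assumes "M = 0 \<or> N = 0"
  shows "(\<Sum>k\<le>K. over_q_summand M N k) = (1 :: 'a::field fps)"
proof -
  have "over_q_summand M N 0 = (1 :: 'a fps)"
    using assms by (auto simp: over_q_summand_def inverse_mult_eq_1')
  moreover have "over_q_summand M N (Suc k) = (0 :: 'a fps)" for k
    using assms by (auto simp: over_q_summand_def)
  ultimately show ?thesis
    by (simp add: sum.atMost_shift)
qed

text \<open>The pairs in the recurrence have different minima in general. With a free upper limit,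
  one \<open>K\<close> serves all of them but (M-1,N-1), for which K - 1 suffices.\<close>

lemma over_q_binomial_eq_sum:
  assumes "min M N \<le> K"
  shows "over_q_binomial M N = (\<Sum>k\<le>K. over_q_summand M N k)"
  using assms
proof (induction "M + N" arbitrary: M N K rule: less_induct)
  case less
  show ?case
  proof (cases "M = 0 \<or> N = 0")
    case True
    then show ?thesis by (simp only: over_q_binomial_0 sum_over_q_summand_0)
  next
    case False
    then obtain M' N' where MN: "M = Suc M'" "N = Suc N'"
      by (auto simp: gr0_conv_Suc)
    with less.prems obtain L where K: "K = Suc L" by (cases K) auto
    have "over_q_binomial M' (Suc N') = (\<Sum>k\<le>K. over_q_summand M' (Suc N') k)"
      "over_q_binomial (Suc M') N' = (\<Sum>k\<le>K. over_q_summand (Suc M') N' k)"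
      "over_q_binomial M' N' = (\<Sum>k\<le>L. over_q_summand M' N' k)"
      using less.prems by (intro less.hyps; simp add: MN K; linarith)+
    then show ?thesis
      by (simp only: MN K over_q_binomial_Suc sum_over_q_summand_Suc)
  qed
qed

theorem theorem1p1:
  fixes M N :: nat and q :: "rat fps"
  assumes "0 < M" and "0 < N"
  defines "q \<equiv> fps_X"
  shows "over_q_binomial M N =
    (\<Sum>k=0..min M N. q ^ (k * (k + 1) div 2) *
       (q_pochhammer q q (M + N - k) /
        (q_pochhammer q q k * q_pochhammer q q (M - k) * q_pochhammer q q (N - k))))"
proof -
  have "over_q_summand M N k = q ^ (k * (k + 1) div 2) *
       (q_pochhammer q q (M + N - k) /
        (q_pochhammer q q k * q_pochhammer q q (M - k) * q_pochhammer q q (N - k)))"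
    if "k \<le> min M N" for k
    \<comment> \<open>The denominator is a unit, so the quotient is a product with its
      inverse.\<close>
    using that unfolding q_def q_factorial_def[symmetric]
    by (simp add: over_q_summand_def fps_divide_unit fps_inverse_mult)
  then show ?thesis
    using over_q_binomial_eq_sum[of M N "min M N"] by (simp add: atMost_atLeast0)
qed

end
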